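(* Let $\mathbb{X}$ be a Banach space such that the set of all strongly exposed points of $B_{\mathbb{X}}$ separates $\mathbb{X}^*$. Let $\mathbb{Y}$ be any Banach space. Then exactly one of the following holds true: (i) $\mathbb{K}(\mathbb{X},\mathbb{Y})=\mathbb{L}(\mathbb{X},\mathbb{Y})$; (ii) $\mathbb{K}(\mathbb{X},\mathbb{Y})$ is anti-coproximinal in $\mathbb{L}(\mathbb{X},\mathbb{Y})$ (as a proper subspace).
   Context: Banach spaces are over $\mathbb{R}$ or $\mathbb{C}$ (the same field for $\mathbb{X}$ and $\mathbb{Y}$); $B_{\mathbb{X}}$ and $S_{\mathbb{X}}$ denote the closed unit ball and unit sphere of $\mathbb{X}$. $\mathbb{L}(\mathbb{X},\mathbb{Y})$ is the Banach space of all bounded linear operators from $\mathbb{X}$ to $\mathbb{Y}$ with the operator norm, and $\mathbb{K}(\mathbb{X},\mathbb{Y})$ its subspace of compact operators. For nonzero $x\in\mathbb{X}$, $J(x)=\{x^*\in S_{\mathbb{X}^*}: x^*(x)=\|x\|\}$. A point $x\in S_{\mathbb{X}}$ is a strongly exposed point of $B_{\mathbb{X}}$ if there exists $x^*\in J(x)$ such that for any sequence $\{x_n\}\subset B_{\mathbb{X}}$, $x^*(x_n)\to1=x^*(x)$ implies $x_n\to x$ in norm. A set $D\subset\mathbb{X}$ separates $\mathbb{X}^*$ if for every nonzero $x^*\in\mathbb{X}^*$ there is $x\in D$ with $x^*(x)\neq0$. For a subspace $\mathbb{W}$ of a Banach space $\mathbb{V}$ and $v\in\mathbb{V}$, $w_0\in\mathbb{W}$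 is a best coapproximation to $v$ out of $\mathbb{W}$ if $\|w_0-w\|\le\|v-w\|$ for all $w\in\mathbb{W}$. $\mathbb{W}$ is anti-coproximinal in $\mathbb{V}$ if for every $v\in\mathbb{V}\setminus\mathbb{W}$ there is no best coapproximation to $v$ out of $\mathbb{W}$. *)

theory Defs
  imports "HOL-Analysis.Analysis"
begin

text \<open>
  The scalar field is a type variable constrained by the following class, whose models are exactly
  the normed fields \<open>\<real>\<close> and \<open>\<complex>\<close>, up to isometric isomorphism. In the first alternative the norm is
  the usual one because \<open>norm (r *\<^sub>R 1) = \<bar>r\<bar>\<close> holds in every \<open>real_normed_field\<close>.
\<close>

class real_or_complex = real_normed_field +
  assumes real_or_complex:
    "(\<forall>x. \<exists>a. x = a *\<^sub>R 1) \<or>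
     (\<exists>i. i * i = - 1 \<and> (\<forall>x. \<exists>a b. x = a *\<^sub>R 1 + b *\<^sub>R i \<and> norm x = sqrt (a\<^sup>2 + b\<^sup>2)))"

instance real :: real_or_complex
  by standard simp

instance complex :: real_or_complex
proof
  have "\<exists>a b. x = a *\<^sub>R 1 + b *\<^sub>R \<i> \<and> norm x = sqrt (a\<^sup>2 + b\<^sup>2)" for x :: complex
    by (rule exI[of _ "Re x"], rule exI[of _ "Im x"]) (simp add: complex_eq_iff cmod_def)
  then show "(\<forall>x::complex. \<exists>a. x = a *\<^sub>R 1) \<or>
      (\<exists>i::complex. i * i = - 1 \<and>
        (\<forall>x. \<exists>a b. x = a *\<^sub>R 1 + b *\<^sub>R i \<and> norm x = sqrt (a\<^sup>2 + b\<^sup>2)))"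
    by (intro disjI2 exI[of _ \<i>]) simp
qed

text \<open>
  A Banach space over \<open>'k\<close>: a real Banach space together with a scalar multiplication by \<open>'k\<close> that
  extends the real one and for which the norm is homogeneous.
\<close>

locale banach_over = vector_space scale
  for scale :: "'k::real_or_complex \<Rightarrow> 'x::banach \<Rightarrow> 'x" +
  assumes scale_of_real: "scale (of_real r) x = r *\<^sub>R x"
    and norm_scale: "norm (scale c x) = norm c * norm x"

lemma banach_over_scaleR: "banach_over ((*\<^sub>R) :: real \<Rightarrow> 'x::banach \<Rightarrow> 'x)"
  by standard (simp_all add: algebra_simps)

lemma banach_over_complex: "banach_over ((*) :: complex \<Rightarrow> complex \<Rightarrow> complex)"
  by standard (simp_all add: algebra_simps norm_mult scaleR_conv_of_real)

text \<open>
  The library type \<open>'x \<Rightarrow>\<^sub>L 'y\<close> consists of the bounded real-linear operators with the operator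
  norm; \<open>bounded_ops\<close> singles out the \<open>'k\<close>-linear ones, with the same norm.
\<close>

definition bounded_ops ::
    "('k::real_or_complex \<Rightarrow> 'x \<Rightarrow> 'x) \<Rightarrow> ('k \<Rightarrow> 'y \<Rightarrow> 'y)
      \<Rightarrow> ('x::real_normed_vector \<Rightarrow>\<^sub>L 'y::real_normed_vector) set"
  where "bounded_ops sX sY = {T. Vector_Spaces.linear sX sY (blinfun_apply T)}"

definition compact_ops ::
    "('k::real_or_complex \<Rightarrow> 'x \<Rightarrow> 'x) \<Rightarrow> ('k \<Rightarrow> 'y \<Rightarrow> 'y)
      \<Rightarrow> ('x::real_normed_vector \<Rightarrow>\<^sub>L 'y::real_normed_vector) set"
  where "compact_ops sX sY =
    {T \<in> bounded_ops sX sY. compact (closure (blinfun_apply T ` cball 0 1))}"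

definition dual_space ::
    "('k::real_or_complex \<Rightarrow> 'x \<Rightarrow> 'x) \<Rightarrow> ('x::real_normed_vector \<Rightarrow>\<^sub>L 'k) set"
  where "dual_space sX = bounded_ops sX (*)"

definition support_functionals ::
    "('k::real_or_complex \<Rightarrow> 'x \<Rightarrow> 'x) \<Rightarrow> 'x \<Rightarrow> ('x::real_normed_vector \<Rightarrow>\<^sub>L 'k) set"
  where "support_functionals sX x =
    {f \<in> dual_space sX. norm f = 1 \<and> blinfun_apply f x = of_real (norm x)}"

definition strongly_exposed_point ::
    "('k::real_or_complex \<Rightarrow> 'x \<Rightarrow> 'x) \<Rightarrow> 'x::real_normed_vector \<Rightarrow> bool"
  where "strongly_exposed_point sX x \<longleftrightarrow> x \<in> sphere 0 1 \<and>
    (\<exists>f \<in> support_functionals sX x.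
       \<forall>u :: nat \<Rightarrow> 'x. (\<forall>n. u n \<in> cball 0 1) \<longrightarrow>
         (\<lambda>n. blinfun_apply f (u n)) \<longlonglongrightarrow> 1 \<longrightarrow> u \<longlonglongrightarrow> x)"

definition separates_dual ::
    "('k::real_or_complex \<Rightarrow> 'x \<Rightarrow> 'x) \<Rightarrow> 'x::real_normed_vector set \<Rightarrow> bool"
  where "separates_dual sX D \<longleftrightarrow>
    (\<forall>f \<in> dual_space sX. f \<noteq> 0 \<longrightarrow> (\<exists>x \<in> D. blinfun_apply f x \<noteq> 0))"

definition best_coapproximation :: "'v::real_normed_vector set \<Rightarrow> 'v \<Rightarrow> 'v \<Rightarrow> bool"
  where "best_coapproximation W v w0 \<longleftrightarrow>
    w0 \<in> W \<and> (\<forall>w \<in> W. norm (w0 - w) \<le> norm (v - w))"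

definition anti_coproximinal ::
    "('k::real_or_complex \<Rightarrow> 'v \<Rightarrow> 'v) \<Rightarrow> 'v::real_normed_vector set \<Rightarrow> 'v set \<Rightarrow> bool"
  where "anti_coproximinal s W V \<longleftrightarrow>
    module.subspace s W \<and> module.subspace s V \<and> W \<subseteq> V \<and>
    (\<forall>v \<in> V - W. \<nexists>w0. best_coapproximation W v w0)"

definition op_scale ::
    "('k::real_or_complex \<Rightarrow> 'y \<Rightarrow> 'y) \<Rightarrow> 'k
      \<Rightarrow> ('x::real_normed_vector \<Rightarrow>\<^sub>L 'y) \<Rightarrow> ('x \<Rightarrow>\<^sub>L 'y::real_normed_vector)"
  where "op_scale sY c T = Blinfun (\<lambda>x. sY c (blinfun_apply T x))"

text \<open>
  \<open>op_scale\<close> is the intended scalar multiplication on operators, and with respect to it the bounded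
  and the compact operators form subspaces.
\<close>

lemma (in banach_over) bounded_linear_scale: "bounded_linear (scale c)"
proof (rule bounded_linear_intro)
  show "scale c (x + y) = scale c x + scale c y" for x y
    by (rule scale_right_distrib)
  show "scale c (r *\<^sub>R x) = r *\<^sub>R scale c x" for r x
    by (metis scale_of_real scale_left_commute)
  show "norm (scale c x) \<le> norm x * norm c" for x
    by (simp add: norm_scale)
qed

lemma op_scale_apply:
  fixes T :: "'x::real_normed_vector \<Rightarrow>\<^sub>L 'y::banach"
  assumes "banach_over sY"
  shows "blinfun_apply (op_scale sY c T) x = sY c (blinfun_apply T x)"
  unfolding op_scale_def
  by (subst bounded_linear_Blinfun_apply)
    (auto intro: bounded_linear_compose[OF banach_over.bounded_linear_scale[OF assms]]
      blinfun.bounded_linear_right)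

lemma banach_over_op_scale:
  assumes "banach_over (sY :: 'k::real_or_complex \<Rightarrow> 'y::banach \<Rightarrow> 'y)"
  shows "banach_over (op_scale sY :: 'k \<Rightarrow> ('x::real_normed_vector \<Rightarrow>\<^sub>L 'y) \<Rightarrow> _)"
proof -
  interpret Y: banach_over sY by fact
  note a = op_scale_apply[OF assms]
  show ?thesis
  proof
    fix c d :: 'k and r :: real and S T :: "'x \<Rightarrow>\<^sub>L 'y"
    show "op_scale sY c (S + T) = op_scale sY c S + op_scale sY c T"
      by (rule blinfun_eqI) (simp add: a blinfun.add_left Y.scale_right_distrib)
    show "op_scale sY (c + d) T = op_scale sY c T + op_scale sY d T"
      by (rule blinfun_eqI) (simp add: a blinfun.add_left Y.scale_left_distrib)
    show "op_scale sY c (op_scale sY d T) = op_scale sY (c * d) T"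
      by (rule blinfun_eqI) (simp add: a)
    show "op_scale sY 1 T = T"
      by (rule blinfun_eqI) (simp add: a)
    show "op_scale sY (of_real r) T = r *\<^sub>R T"
      by (rule blinfun_eqI) (simp add: a blinfun.scaleR_left Y.scale_of_real)
    have le: "norm (op_scale sY e R) \<le> norm e * norm R" for e and R :: "'x \<Rightarrow>\<^sub>L 'y"
    proof (rule norm_blinfun_bound)
      show "norm (blinfun_apply (op_scale sY e R) x) \<le> norm e * norm R * norm x" for x
        using mult_left_mono[OF norm_blinfun[of R x] norm_ge_zero[of e]]
        by (simp add: a Y.norm_scale mult.assoc)
    qed simp
    show "norm (op_scale sY c T) = norm c * norm T"
    proof (cases "c = 0")
      case True
      then show ?thesis using le[of 0 T] by simp
    next
      case False
      then have "op_scale sY (inverse c) (op_scale sY c T) = T"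
        by (intro blinfun_eqI) (simp add: a)
      then have "norm T \<le> inverse (norm c) * norm (op_scale sY c T)"
        using le[of "inverse c" "op_scale sY c T"] by (simp add: norm_inverse)
      then show ?thesis
        using le[of c T] False by (simp add: field_simps)
    qed
  qed
qed

lemma subspace_bounded_ops:
  assumes "banach_over (sX :: 'k::real_or_complex \<Rightarrow> 'x::banach \<Rightarrow> 'x)"
    and "banach_over (sY :: 'k \<Rightarrow> 'y::banach \<Rightarrow> 'y)"
  shows "module.subspace (op_scale sY) (bounded_ops sX sY)"
proof -
  interpret X: banach_over sX by fact
  interpret Y: banach_over sY by fact
  interpret L: banach_over "op_scale sY :: 'k \<Rightarrow> ('x \<Rightarrow>\<^sub>L 'y) \<Rightarrow> _"
    by (rule banach_over_op_scale) fact
  have lin: "T \<in> bounded_ops sX sY \<longleftrightarrow>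
      (\<forall>c x. blinfun_apply T (sX c x) = sY c (blinfun_apply T x))" for T
    unfolding bounded_ops_def mem_Collect_eq Vector_Spaces.linear_def module_hom_def
      module_hom_axioms_def module_def
    using X.vector_space_axioms Y.vector_space_axioms X.module_axioms Y.module_axioms
    by (auto simp: blinfun.add_right module_def)
  show ?thesis
    by (rule L.subspaceI)
      (auto simp: lin blinfun.add_left op_scale_apply[OF assms(2)] Y.scale_right_distrib
        Y.scale_left_commute)
qed

lemma subspace_compact_ops:
  assumes "banach_over (sX :: 'k::real_or_complex \<Rightarrow> 'x::banach \<Rightarrow> 'x)"
    and "banach_over (sY :: 'k \<Rightarrow> 'y::banach \<Rightarrow> 'y)"
  shows "module.subspace (op_scale sY) (compact_ops sX sY)"
proof -
  interpret Y: banach_over sY by fact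
  interpret L: banach_over "op_scale sY :: 'k \<Rightarrow> ('x \<Rightarrow>\<^sub>L 'y) \<Rightarrow> _"
    by (rule banach_over_op_scale) fact
  note sub = subspace_bounded_ops[OF assms]
  have sup: "compact (closure A)" if "compact B" "A \<subseteq> B" for A B :: "'y set"
    using that by (metis closed_Int_compact closed_closure closure_minimal compact_imp_closed
        inf.absorb_iff1)
  show ?thesis
  proof (rule L.subspaceI)
    have "blinfun_apply (0 :: 'x \<Rightarrow>\<^sub>L 'y) ` cball 0 1 \<subseteq> {0}" by auto
    then show "0 \<in> compact_ops sX sY"
      using L.subspace_0[OF sub] sup[of "{0}"] by (simp add: compact_ops_def)
  next
    fix S T assume S: "S \<in> compact_ops sX sY" and T: "T \<in> compact_ops sX sY"
    have "blinfun_apply (S + T) ` cball 0 1 \<subseteq>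
        {x + y |x y. x \<in> closure (blinfun_apply S ` cball 0 1) \<and>
          y \<in> closure (blinfun_apply T ` cball 0 1)}"
      by (auto simp: blinfun.add_left) (metis closure_subset image_eqI mem_cball_0 subsetD)
    moreover have "compact {x + y |x y. x \<in> closure (blinfun_apply S ` cball 0 1) \<and>
          y \<in> closure (blinfun_apply T ` cball 0 1)}"
      using S T by (intro compact_sums) (auto simp: compact_ops_def)
    ultimately show "S + T \<in> compact_ops sX sY"
      using S T L.subspace_add[OF sub] sup by (simp add: compact_ops_def)
  next
    fix c T assume T: "T \<in> compact_ops sX sY"
    have "blinfun_apply (op_scale sY c T) ` cball 0 1 \<subseteq>
        sY c ` closure (blinfun_apply T ` cball 0 1)"
      using closure_subset by (fastforce simp: op_scale_apply[OF assms(2)])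
    moreover have "compact (sY c ` closure (blinfun_apply T ` cball 0 1))"
      using T by (intro compact_continuous_image linear_continuous_on Y.bounded_linear_scale)
        (simp add: compact_ops_def)
    ultimately show "op_scale sY c T \<in> compact_ops sX sY"
      using T L.subspace_scale[OF sub] sup by (simp add: compact_ops_def)
  qed
qed

end

theory Submission
  imports Defs
begin

text \<open>
  Suppose that a non-compact operator \<open>v\<close> had a best coapproximation \<open>w\<^sub>0\<close> out of the compact
  operators and put \<open>V = v - w\<^sub>0\<close>, so that \<open>norm W \<le> norm (V - W)\<close> for every compact \<open>W\<close>. Let \<open>f\<close>
  strongly expose \<open>x\<close> and suppose that \<open>V x \<noteq> 0\<close>; let \<open>y\<close> be the unit vector in the direction of
  \<open>V x\<close>. The rank-one operators \<open>u \<mapsto> n f(u) y\<close> are compact of norm at least \<open>n\<close>, so \<open>V\<close> minus such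
  an operator nearly has norm \<open>n\<close> at some \<open>u\<^sub>n\<close> in the unit ball. For large \<open>n\<close> this
  forces \<open>\<bar>f(u\<^sub>n)\<bar>\<close> towards \<open>1\<close>, hence, after a rotation by a unimodular scalar, \<open>u\<^sub>n \<longlonglongrightarrow> x\<close>. But near
  \<open>x\<close> the subtracted operator points in the direction of \<open>V x\<close>, so the norm there is only about
  \<open>n - norm (V x)\<close>. Therefore \<open>V\<close> vanishes at all strongly exposed points
  (lemma \<open>coapproximation_zero_at_exposed\<close>).

  Consequently \<open>g \<circ> V\<close> vanishes at all strongly exposed points for every bounded functional \<open>g\<close> on
  the range space, so \<open>g \<circ> V = 0\<close> because these points separate the dual. Functionals separate points
  by the Hahn-Banach theorem (lemma \<open>ex_dual_nonzero\<close>), so \<open>V = 0\<close> and \<open>v = w\<^sub>0\<close> is compact, a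
  contradiction.

  The Hahn-Banach theorem is obtained from minimal sublinear functionals: Zorn's lemma gives a
  minimal sublinear functional below any given one, and minimal sublinear functionals are linear.
\<close>

section \<open>Sublinear functionals and the Hahn-Banach theorem\<close>

text \<open>
  Positive homogeneity is only demanded as an inequality for \<open>r > 0\<close>; applying it to \<open>r\<close> and
  \<open>inverse r\<close> gives equality.
\<close>

definition sublinear :: "('a::real_vector \<Rightarrow> real) \<Rightarrow> bool"
  where "sublinear p \<longleftrightarrow>
    (\<forall>x y. p (x + y) \<le> p x + p y) \<and> (\<forall>r x. r > 0 \<longrightarrow> p (r *\<^sub>R x) \<le> r * p x)"

lemma sublinear_add: "sublinear p \<Longrightarrow> p (x + y) \<le> p x + p y"
  by (simp add: sublinear_def)

lemma sublinear_scaleR_pos: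
  assumes "sublinear p" "r > 0"
  shows "p (r *\<^sub>R x) = r * p x"
proof (rule antisym)
  show "p (r *\<^sub>R x) \<le> r * p x" using assms by (simp add: sublinear_def)
  have "p (inverse r *\<^sub>R (r *\<^sub>R x)) \<le> inverse r * p (r *\<^sub>R x)"
    using assms unfolding sublinear_def by (meson positive_imp_inverse_positive)
  then show "r * p x \<le> p (r *\<^sub>R x)" using assms by (simp add: field_simps)
qed

lemma sublinear_0: "sublinear p \<Longrightarrow> p 0 = 0"
  using sublinear_scaleR_pos[of p 2 0] by simp

lemma sublinear_minus: "sublinear p \<Longrightarrow> - p (- x) \<le> p x"
  using sublinear_add[of p x "- x"] sublinear_0[of p] by simp

lemma sublinear_scaleR: "sublinear p \<Longrightarrow> r \<ge> 0 \<Longrightarrow> p (r *\<^sub>R x) = r * p x"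
  by (cases "r = 0") (auto simp: sublinear_0 sublinear_scaleR_pos)

lemma sublinear_norm: "sublinear norm"
  by (simp add: sublinear_def norm_triangle_ineq)

lemma sublinear_INF:
  fixes F :: "'i \<Rightarrow> 'a::real_vector \<Rightarrow> real"
  assumes "I \<noteq> {}"
    and bdd: "\<And>x. bdd_below ((\<lambda>i. F i x) ` I)"
    and add: "\<And>i j x y. i \<in> I \<Longrightarrow> j \<in> I \<Longrightarrow> \<exists>k\<in>I. F k (x + y) \<le> F i x + F j y"
    and scale: "\<And>i r x. i \<in> I \<Longrightarrow> r > 0 \<Longrightarrow> \<exists>k\<in>I. F k (r *\<^sub>R x) \<le> r * F i x"
  shows "sublinear (\<lambda>x. INF i\<in>I. F i x)"
proof -
  have add': "(INF i\<in>I. F i (x + y)) \<le> F i x + F j y" if ij: "i \<in> I" "j \<in> I" for x y i j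
  proof -
    obtain k where "k \<in> I" "F k (x + y) \<le> F i x + F j y" using add[OF ij] by blast
    then show ?thesis using cINF_lower[OF bdd] order_trans by blast
  qed
  have "(INF i\<in>I. F i (x + y)) - F j y \<le> (INF i\<in>I. F i x)" if "j \<in> I" for x y j
    using \<open>I \<noteq> {}\<close> add'[OF _ that, of _ x y] by (intro cINF_greatest) (auto simp: algebra_simps)
  then have "(INF i\<in>I. F i (x + y)) - (INF i\<in>I. F i x) \<le> (INF j\<in>I. F j y)" for x y
    using \<open>I \<noteq> {}\<close> by (intro cINF_greatest) (auto simp: algebra_simps)
  moreover have "(INF i\<in>I. F i (r *\<^sub>R x)) / r \<le> (INF i\<in>I. F i x)" if "r > 0" for r x
  proof (rule cINF_greatest[OF \<open>I \<noteq> {}\<close>])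
    fix i assume "i \<in> I"
    then obtain k where "k \<in> I" "F k (r *\<^sub>R x) \<le> r * F i x" using scale \<open>r > 0\<close> by blast
    then have "(INF i\<in>I. F i (r *\<^sub>R x)) \<le> r * F i x"
      using cINF_lower[OF bdd] order_trans by blast
    then show "(INF i\<in>I. F i (r *\<^sub>R x)) / r \<le> F i x" using \<open>r > 0\<close> by (simp add: field_simps)
  qed
  ultimately show ?thesis unfolding sublinear_def by (auto simp: field_simps)
qed

text \<open>
  For sublinear \<open>p\<close>, the largest sublinear functional that lies below \<open>p\<close> and takes the value \<open>- p y\<close> at \<open>- y\<close>; any
  linear functional below it agrees with \<open>p\<close> at \<open>y\<close>.
\<close>

definition flatten_at :: "('a::real_vector \<Rightarrow> real) \<Rightarrow> 'a \<Rightarrow> 'a \<Rightarrow> real"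
  where "flatten_at p y x = (INF t\<in>{0..}. p (x + t *\<^sub>R y) - t * p y)"

lemma bdd_below_flatten_at:
  assumes "sublinear p"
  shows "bdd_below ((\<lambda>t. p (x + t *\<^sub>R y) - t * p y) ` {0..})"
proof (rule bdd_belowI2)
  fix t :: real assume "t \<in> {0..}"
  then have "t * p y = p ((x + t *\<^sub>R y) + - x)" using assms by (simp add: sublinear_scaleR)
  then show "- p (- x) \<le> p (x + t *\<^sub>R y) - t * p y"
    using sublinear_add[OF assms, of "x + t *\<^sub>R y" "- x"] by linarith
qed

lemma flatten_at_le:
  assumes "sublinear p" "t \<ge> 0"
  shows "flatten_at p y x \<le> p (x + t *\<^sub>R y) - t * p y"
  unfolding flatten_at_def using assms
  by (intro cINF_lower bdd_below_flatten_at) auto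

lemma sublinear_flatten_at:
  assumes "sublinear p"
  shows "sublinear (flatten_at p y)"
  unfolding flatten_at_def
proof (rule sublinear_INF)
  fix s t :: real and u v assume st: "s \<in> {0..}" "t \<in> {0..}"
  have "p ((u + v) + (s + t) *\<^sub>R y) \<le> p (u + s *\<^sub>R y) + p (v + t *\<^sub>R y)"
    using sublinear_add[OF assms, of "u + s *\<^sub>R y" "v + t *\<^sub>R y"] by (simp add: algebra_simps)
  then show "\<exists>k\<in>{0..}. p ((u + v) + k *\<^sub>R y) - k * p y
      \<le> (p (u + s *\<^sub>R y) - s * p y) + (p (v + t *\<^sub>R y) - t * p y)"
    using st by (intro bexI[of _ "s + t"]) (auto simp: algebra_simps)
next
  fix t r :: real and u assume t: "t \<in> {0..}" and r: "r > 0"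
  have "p (r *\<^sub>R u + (r * t) *\<^sub>R y) = r * p (u + t *\<^sub>R y)"
    using sublinear_scaleR_pos[OF assms r, of "u + t *\<^sub>R y"] by (simp add: algebra_simps)
  then show "\<exists>k\<in>{0..}. p (r *\<^sub>R u + k *\<^sub>R y) - k * p y \<le> r * (p (u + t *\<^sub>R y) - t * p y)"
    using t r by (intro bexI[of _ "r * t"]) (auto simp: algebra_simps)
qed (auto intro: bdd_below_flatten_at assms)

lemma ex_minimal_sublinear:
  fixes q :: "'a::real_vector \<Rightarrow> real"
  assumes q: "sublinear q"
  obtains p where "sublinear p" "p \<le> q" "\<And>p'. sublinear p' \<Longrightarrow> p' \<le> p \<Longrightarrow> p' = p"
proof -
  let ?A = "{p. sublinear p \<and> p \<le> q}"
  have "\<exists>m\<in>?A. \<forall>a\<in>?A. m \<ge> a \<longrightarrow> a = m"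
  proof (rule predicate_Zorn)
    show "partial_order_on ?A (relation_of (\<ge>) ?A)"
      by (rule partial_order_on_relation_ofI) auto
  next
    fix C assume "C \<in> Chains (relation_of (\<ge>) ?A)"
    then have C: "C \<subseteq> ?A" and chain: "\<And>a b. a \<in> C \<Longrightarrow> b \<in> C \<Longrightarrow> a \<le> b \<or> b \<le> a"
      unfolding Chains_def relation_of_def by auto
    show "\<exists>u\<in>?A. \<forall>a\<in>C. u \<le> a"
    proof (cases "C = {}")
      case True
      then show ?thesis using q by auto
    next
      case False
      have bdd: "bdd_below ((\<lambda>p. p x) ` C)" for x
      proof (rule bdd_belowI2)
        fix p assume "p \<in> C"
        with C have p: "sublinear p" and le: "p (- x) \<le> q (- x)" by (auto simp: le_fun_def)
        show "- q (- x) \<le> p x" using sublinear_minus[OF p, of x] le by linarith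
      qed
      have "sublinear (\<lambda>x. INF p\<in>C. p x)"
      proof (rule sublinear_INF[OF False bdd])
        fix a b x y assume ab: "a \<in> C" "b \<in> C"
        have sub: "c (x + y) \<le> c x + c y" if "c \<in> C" for c
          using that C by (auto intro: sublinear_add)
        \<comment> \<open>The smaller of the two members of the chain serves for both summands.\<close>
        from chain[OF ab] show "\<exists>k\<in>C. k (x + y) \<le> a x + b y"
        proof
          assume "a \<le> b"
          then have "a (x + y) \<le> a x + b y" using sub[OF ab(1)] le_funD[of a b y] by linarith
          then show ?thesis using ab by blast
        next
          assume "b \<le> a"
          then have "b (x + y) \<le> a x + b y" using sub[OF ab(2)] le_funD[of b a x] by linarith
          then show ?thesis using ab by blast
        qed
      next
        fix a r x assume "a \<in> C" "(r::real) > 0"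
        then show "\<exists>k\<in>C. k (r *\<^sub>R x) \<le> r * a x"
          using C by (auto simp: sublinear_scaleR_pos intro!: bexI[of _ a])
      qed
      moreover have le: "(\<lambda>x. INF p\<in>C. p x) \<le> a" if "a \<in> C" for a
        using that by (auto simp: le_fun_def intro: cINF_lower[OF bdd])
      moreover have "(\<lambda>x. INF p\<in>C. p x) \<le> q"
        using False C le by (blast intro: order_trans)
      ultimately show ?thesis by blast
    qed
  qed
  then show ?thesis using that by (auto intro: order_trans)
qed

lemma linear_of_minimal_sublinear:
  assumes p: "sublinear p" and min: "\<And>p'. sublinear p' \<Longrightarrow> p' \<le> p \<Longrightarrow> p' = p"
  shows "linear p"
proof -
  have "flatten_at p y = p" for y
    using flatten_at_le[OF p order_refl, of y]
    by (intro min sublinear_flatten_at p) (simp add: le_fun_def)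
  then have "p x \<le> p (x + y) - p y" for x y
    using flatten_at_le[OF p, of 1 y x] by simp
  then have add: "p (x + y) = p x + p y" for x y
    using sublinear_add[OF p, of x y] by (smt (verit))
  have neg: "p (- x) = - p x" for x
    using add[of x "- x"] sublinear_0[OF p] by simp
  show ?thesis
  proof (rule linearI[OF add])
    show "p (r *\<^sub>R x) = r *\<^sub>R p x" for r x
      using sublinear_scaleR[OF p, of r x] sublinear_scaleR[OF p, of "- r" x] neg[of "r *\<^sub>R x"]
      by (cases "r \<ge> 0") auto
  qed
qed

theorem hahn_banach_sublinear:
  assumes "sublinear q"
  obtains g where "linear g" "g \<le> q"
  using ex_minimal_sublinear[OF assms] linear_of_minimal_sublinear by metis

corollary hahn_banach_norming:
  fixes y :: "'a::real_normed_vector"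
  obtains g :: "'a \<Rightarrow> real" where "bounded_linear g" "g y = norm y"
proof -
  obtain g where g: "linear g" and le: "g \<le> flatten_at norm y"
    using hahn_banach_sublinear[OF sublinear_flatten_at[OF sublinear_norm]] by blast
  have bound: "g x \<le> norm (x + t *\<^sub>R y) - t * norm y" if "t \<ge> 0" for t x
    using le_funD[OF le, of x] flatten_at_le[OF sublinear_norm that, of y x] by linarith
  have le_norm: "g x \<le> norm x" for x using bound[of 0 x] by simp
  have "\<bar>g x\<bar> \<le> norm x" for x
    using le_norm[of x] le_norm[of "- x"] linear_neg[OF g, of x] by simp
  then have "bounded_linear g"
    using g by (intro bounded_linear_intro[where K = 1]) (auto simp: linear_add linear_scale)
  moreover have "g y = norm y"
    using bound[of 1 "- y"] le_norm[of y] linear_neg[OF g, of y] by simp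
  ultimately show thesis by (rule that)
qed

section \<open>Linear operators over the common scalar field\<close>

text \<open>
  In both cases the scalars are spanned by \<open>1\<close> and a further element, with coordinates bounded by the
  norm; over the reals the second coordinate can be taken to be zero.
\<close>

lemma real_or_complex_coordinates:
  obtains i :: "'k::real_or_complex"
  where "\<And>k. \<exists>a b. k = of_real a + of_real b * i \<and> \<bar>a\<bar> \<le> norm k \<and> \<bar>b\<bar> \<le> norm k"
  using real_or_complex[where 'a = 'k]
proof
  assume "\<forall>x::'k. \<exists>a. x = a *\<^sub>R 1"
  then have "\<exists>a b. k = of_real a + of_real b * 0 \<and> \<bar>a\<bar> \<le> norm k \<and> \<bar>b\<bar> \<le> norm k" for k :: 'k
    by (metis add.right_neutral mult_zero_right norm_of_real norm_ge_zero of_real_def order_refl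
        abs_zero)
  then show thesis by (rule that)
next
  assume "\<exists>i::'k. i * i = - 1 \<and> (\<forall>x. \<exists>a b. x = a *\<^sub>R 1 + b *\<^sub>R i \<and> norm x = sqrt (a\<^sup>2 + b\<^sup>2))"
  then obtain i :: 'k
    where i: "\<And>x. \<exists>a b. x = a *\<^sub>R 1 + b *\<^sub>R i \<and> norm x = sqrt (a\<^sup>2 + b\<^sup>2)" by blast
  have "\<exists>a b. k = of_real a + of_real b * i \<and> \<bar>a\<bar> \<le> norm k \<and> \<bar>b\<bar> \<le> norm k" for k
  proof -
    obtain a b where "k = a *\<^sub>R 1 + b *\<^sub>R i" "norm k = sqrt (a\<^sup>2 + b\<^sup>2)" using i by blast
    then show ?thesis
      by (intro exI[of _ a] exI[of _ b]) (simp add: scaleR_conv_of_real real_le_rsqrt)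
  qed
  then show thesis by (rule that)
qed

lemma bounded_ops_iff:
  assumes "banach_over sX" "banach_over sY"
  shows "T \<in> bounded_ops sX sY \<longleftrightarrow>
    (\<forall>c x. blinfun_apply T (sX c x) = sY c (blinfun_apply T x))"
proof -
  interpret X: banach_over sX by fact
  interpret Y: banach_over sY by fact
  show ?thesis
    unfolding bounded_ops_def mem_Collect_eq Vector_Spaces.linear_def module_hom_def
      module_hom_axioms_def
    using X.vector_space_axioms Y.vector_space_axioms X.module_axioms Y.module_axioms
    by (auto simp: blinfun.add_right)
qed

lemma dual_space_iff:
  fixes sX :: "'k::real_or_complex \<Rightarrow> 'x::banach \<Rightarrow> 'x"
  assumes "banach_over sX"
  shows "f \<in> dual_space sX \<longleftrightarrow> (\<forall>c x. blinfun_apply f (sX c x) = c * blinfun_apply f x)"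
proof -
  interpret X: banach_over sX by fact
  have "vector_space ((*) :: 'k \<Rightarrow> 'k \<Rightarrow> 'k)"
    by standard (simp_all add: algebra_simps)
  then show ?thesis
    unfolding dual_space_def bounded_ops_def mem_Collect_eq Vector_Spaces.linear_def
      module_hom_def module_hom_axioms_def
    using X.vector_space_axioms X.module_axioms
    by (auto simp: blinfun.add_right vector_space_def module_def)
qed

lemma ex_dual_nonzero:
  fixes sY :: "'k::real_or_complex \<Rightarrow> 'y::banach \<Rightarrow> 'y"
  assumes "banach_over sY" "y \<noteq> 0"
  obtains g where "g \<in> dual_space sY" "blinfun_apply g y \<noteq> 0"
proof -
  interpret Y: banach_over sY by fact
  obtain h :: "'y \<Rightarrow> real" where h: "bounded_linear h" and hy: "h y = norm y"
    by (rule hahn_banach_norming)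
  interpret h: bounded_linear h by fact
  have ofr: "bounded_linear (\<lambda>x. of_real (h x) :: 'k)"
    by (rule bounded_linear_compose[OF bounded_linear_of_real h])
  from real_or_complex[where 'a = 'k] show thesis
  proof
    assume real: "\<forall>x::'k. \<exists>a. x = a *\<^sub>R 1"
    have "of_real (h (sY c x)) = c * of_real (h x)" for c x
    proof -
      obtain a where "c = of_real a" using real by (auto simp: scaleR_conv_of_real)
      then show ?thesis by (simp add: Y.scale_of_real h.scaleR)
    qed
    then have "Blinfun (\<lambda>x. of_real (h x) :: 'k) \<in> dual_space sY"
      using dual_space_iff[OF assms(1)] by (simp add: bounded_linear_Blinfun_apply[OF ofr])
    then show thesis
      by (rule that) (use hy \<open>y \<noteq> 0\<close> in \<open>simp add: bounded_linear_Blinfun_apply[OF ofr]\<close>)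
  next
    assume "\<exists>i::'k. i * i = - 1 \<and>
      (\<forall>x. \<exists>a b. x = a *\<^sub>R 1 + b *\<^sub>R i \<and> norm x = sqrt (a\<^sup>2 + b\<^sup>2))"
    then obtain i :: 'k where ii: "i * i = - 1" and i: "\<And>x. \<exists>a b. x = of_real a + of_real b * i"
      by (metis scaleR_conv_of_real mult.right_neutral)
    \<comment> \<open>The complex functional with real part \<open>h\<close>.\<close>
    define G where "G x = of_real (h x) - i * of_real (h (sY i x))" for x
    have G: "bounded_linear G"
      unfolding G_def
      by (intro bounded_linear_sub bounded_linear_const_mult ofr
          bounded_linear_compose[OF ofr] Y.bounded_linear_scale)
    interpret G: bounded_linear G by (fact G)
    have Gi: "G (sY i x) = i * G x" for x
    proof -
      have "sY i (sY i x) = - x" by (simp add: ii)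
      then have "G (sY i x) = of_real (h (sY i x)) + i * of_real (h x)"
        by (simp add: G_def h.neg)
      also have "\<dots> = i * of_real (h x) - (i * i) * of_real (h (sY i x))"
        by (simp add: ii)
      also have "\<dots> = i * G x" by (simp add: G_def algebra_simps)
      finally show ?thesis .
    qed
    have "G (sY c x) = c * G x" for c x
    proof -
      obtain a b where c: "c = of_real a + of_real b * i" using i by blast
      have "sY c x = a *\<^sub>R x + b *\<^sub>R sY i x"
        by (simp add: c Y.scale_left_distrib Y.scale_of_real flip: Y.scale_scale)
      then show ?thesis
        by (simp add: G.add G.scaleR Gi c scaleR_conv_of_real algebra_simps)
    qed
    then have "Blinfun G \<in> dual_space sY"
      using dual_space_iff[OF assms(1)] by (simp add: bounded_linear_Blinfun_apply[OF G])
    moreover have "G y \<noteq> 0"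
    proof
      let ?b = "h (sY i y)"
      assume "G y = 0"
      \<comment> \<open>Squaring gives \<open>(norm y)\<^sup>2 = - ?b\<^sup>2\<close>, so that \<open>y = 0\<close>.\<close>
      then have eq: "of_real (norm y) = i * of_real ?b" by (simp add: G_def hy)
      have "of_real (norm y * norm y) = (i * i) * (of_real ?b * of_real ?b)"
        unfolding of_real_mult eq by (simp add: algebra_simps)
      also have "\<dots> = of_real (- (?b * ?b))" by (simp add: ii)
      finally have "norm y * norm y = - (?b * ?b)" by (simp only: of_real_eq_iff)
      then have "norm y * norm y \<le> 0" by simp
      then show False using \<open>y \<noteq> 0\<close> by (simp add: mult_le_0_iff)
    qed
    ultimately show thesis
      using that by (simp add: bounded_linear_Blinfun_apply[OF G])
  qed
qed

lemma rank_one_compact_op: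
  fixes sX :: "'k::real_or_complex \<Rightarrow> 'x::banach \<Rightarrow> 'x"
    and sY :: "'k \<Rightarrow> 'y::banach \<Rightarrow> 'y"
  assumes X: "banach_over sX" and Y: "banach_over sY" and f: "f \<in> dual_space sX"
  obtains W where "W \<in> compact_ops sX sY"
    "\<And>x. blinfun_apply W x = sY (blinfun_apply f x) z"
proof -
  interpret Y: banach_over sY by fact
  have "bounded_linear (\<lambda>k. sY k z)"
  proof (rule bounded_linear_intro)
    show "sY (j + k) z = sY j z + sY k z" for j k by (rule Y.scale_left_distrib)
    show "sY (r *\<^sub>R k) z = r *\<^sub>R sY k z" for r k
      by (simp add: scaleR_conv_of_real flip: Y.scale_scale Y.scale_of_real)
    show "norm (sY k z) \<le> norm k * norm z" for k by (simp add: Y.norm_scale)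
  qed
  then have bl: "bounded_linear (\<lambda>x. sY (blinfun_apply f x) z)"
    by (rule bounded_linear_compose) (rule blinfun.bounded_linear_right)
  define W where "W = Blinfun (\<lambda>x. sY (blinfun_apply f x) z)"
  have W: "blinfun_apply W x = sY (blinfun_apply f x) z" for x
    by (simp add: W_def bounded_linear_Blinfun_apply[OF bl])
  have "W \<in> bounded_ops sX sY"
    using f by (simp add: bounded_ops_iff[OF X Y] dual_space_iff[OF X] W)
  moreover have "compact (closure (blinfun_apply W ` cball 0 1))"
  proof -
    obtain i :: 'k
      where i: "\<And>k. \<exists>a b. k = of_real a + of_real b * i \<and> \<bar>a\<bar> \<le> norm k \<and> \<bar>b\<bar> \<le> norm k"
      by (rule real_or_complex_coordinates) blast
    let ?C = "{- norm f..norm f} \<times> {- norm f..norm f}"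
    let ?B = "(\<lambda>(a, b). a *\<^sub>R z + b *\<^sub>R sY i z) ` ?C"
    have "compact ?B"
      by (intro compact_continuous_image compact_Times)
        (auto simp: case_prod_unfold intro!: continuous_intros)
    moreover have "blinfun_apply W ` cball 0 1 \<subseteq> ?B"
    proof
      fix w assume "w \<in> blinfun_apply W ` cball 0 1"
      then obtain x where x: "norm x \<le> 1" and w: "w = sY (blinfun_apply f x) z"
        by (auto simp: W)
      obtain a b where ab: "blinfun_apply f x = of_real a + of_real b * i"
        "\<bar>a\<bar> \<le> norm (blinfun_apply f x)" "\<bar>b\<bar> \<le> norm (blinfun_apply f x)"
        using i by blast
      have "norm (blinfun_apply f x) \<le> norm f"
        using norm_blinfun[of f x] mult_left_mono[OF x, of "norm f"] by simp
      then have "(a, b) \<in> ?C" using ab by auto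
      moreover have "w = a *\<^sub>R z + b *\<^sub>R sY i z"
        by (simp add: w ab(1) Y.scale_left_distrib Y.scale_of_real flip: Y.scale_scale)
      ultimately show "w \<in> ?B" by (force intro: image_eqI[where x = "(a, b)"])
    qed
    ultimately show ?thesis
      by (metis closed_Int_compact closed_closure closure_minimal compact_imp_closed
          inf.absorb_iff1)
  qed
  ultimately have "W \<in> compact_ops sX sY" by (simp add: compact_ops_def)
  then show thesis using W by (rule that)
qed

section \<open>Best coapproximations and strongly exposed points\<close>

lemma norm_blinfun_nearly_attained:
  fixes T :: "'x::real_normed_vector \<Rightarrow>\<^sub>L 'y::real_normed_vector"
  assumes "a < norm T"
  obtains u where "norm u \<le> 1" "a < norm (blinfun_apply T u)"
proof (cases "a < 0")
  case True
  then show thesis using that[of 0] by simp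
next
  case False
  have "\<exists>x. a * norm x < norm (blinfun_apply T x)"
  proof (rule ccontr)
    assume "\<nexists>x. a * norm x < norm (blinfun_apply T x)"
    then have "norm T \<le> a" using False by (intro norm_blinfun_bound) (auto simp: not_less)
    then show False using assms by simp
  qed
  then obtain x where x: "a * norm x < norm (blinfun_apply T x)" by blast
  then have "x \<noteq> 0" by auto
  then show thesis
    using x by (intro that[of "x /\<^sub>R norm x"]) (auto simp: blinfun.scaleR_right field_simps)
qed

lemma coapproximation_zero_at_exposed:
  fixes sX :: "'k::real_or_complex \<Rightarrow> 'x::banach \<Rightarrow> 'x"
    and sY :: "'k \<Rightarrow> 'y::banach \<Rightarrow> 'y"
  assumes X: "banach_over sX" and Y: "banach_over sY"
    and V: "V \<in> bounded_ops sX sY"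
    and le: "\<And>W. W \<in> compact_ops sX sY \<Longrightarrow> norm W \<le> norm (V - W)"
    and x: "strongly_exposed_point sX x"
  shows "blinfun_apply V x = 0"
proof (rule ccontr)
  assume "blinfun_apply V x \<noteq> 0"
  interpret X: banach_over sX by fact
  interpret Y: banach_over sY by fact
  define c where "c = norm (blinfun_apply V x)"
  define y where "y = blinfun_apply V x /\<^sub>R c"
  have "c > 0" using \<open>blinfun_apply V x \<noteq> 0\<close> by (simp add: c_def)
  then have Vx: "blinfun_apply V x = c *\<^sub>R y" and y: "norm y = 1"
    by (auto simp: y_def) (simp add: c_def)
  have nx: "norm x = 1" using x by (simp add: strongly_exposed_point_def)
  obtain f where f: "f \<in> dual_space sX" and nf: "norm f = 1" and fx: "blinfun_apply f x = 1"
    and exposed: "\<And>u :: nat \<Rightarrow> 'x. (\<And>n. u n \<in> cball 0 1) \<Longrightarrow>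
         (\<lambda>n. blinfun_apply f (u n)) \<longlonglongrightarrow> 1 \<Longrightarrow> u \<longlonglongrightarrow> x"
    using x nx unfolding strongly_exposed_point_def support_functionals_def by auto
  have "\<exists>u. norm u \<le> 1 \<and> blinfun_apply f u = of_real (norm (blinfun_apply f u)) \<and>
      real n - c / 2 < norm (blinfun_apply V u - (real n * norm (blinfun_apply f u)) *\<^sub>R y)" for n
  proof -
    obtain W where W: "W \<in> compact_ops sX sY"
      and Wu: "\<And>u. blinfun_apply W u = sY (blinfun_apply f u) (real n *\<^sub>R y)"
      by (rule rank_one_compact_op[OF X Y f]) blast
    \<comment> \<open>Any error in the norm smaller than \<open>c\<close> would do in place of \<open>c / 2\<close>.\<close>
    have "blinfun_apply W x = real n *\<^sub>R y" by (simp add: Wu fx)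
    then have "real n \<le> norm W"
      using norm_blinfun[of W x] by (simp add: nx y)
    then have "real n - c / 2 < norm (V - W)" using le[OF W] \<open>c > 0\<close> by linarith
    then obtain u where u: "norm u \<le> 1" "real n - c / 2 < norm (blinfun_apply (V - W) u)"
      by (rule norm_blinfun_nearly_attained)
    let ?z = "blinfun_apply f u"
    \<comment> \<open>A unimodular scalar that rotates the value of \<open>f\<close> to the nonnegative reals.\<close>
    obtain k :: 'k where k: "norm k = 1" "k * ?z = of_real (norm ?z)"
    proof (cases "?z = 0")
      case True
      then show thesis by (intro that[of 1]) auto
    next
      case False
      then show thesis by (intro that[of "of_real (norm ?z) / ?z"]) (auto simp: norm_divide)
    qed
    let ?u = "sX k u"
    have fu: "blinfun_apply f ?u = of_real (norm ?z)" using f k by (simp add: dual_space_iff[OF X])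
    have "V - W \<in> bounded_ops sX sY"
      using V W by (simp add: compact_ops_def bounded_ops_iff[OF X Y] blinfun.diff_left
          Y.scale_right_diff_distrib)
    then have "norm (blinfun_apply (V - W) ?u) = norm (blinfun_apply (V - W) u)"
      by (simp add: bounded_ops_iff[OF X Y] Y.norm_scale k)
    moreover have "blinfun_apply (V - W) ?u = blinfun_apply V ?u - (real n * norm ?z) *\<^sub>R y"
      by (simp add: blinfun.diff_left Wu fu Y.scale_of_real mult.commute)
    ultimately show ?thesis
      using u fu by (intro exI[of _ ?u]) (simp add: X.norm_scale k)
  qed
  then obtain u where u: "\<And>n. norm (u n) \<le> 1"
    and fu: "\<And>n. blinfun_apply f (u n) = of_real (norm (blinfun_apply f (u n)))"
    and lower: "\<And>n. real n - c / 2 <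
      norm (blinfun_apply V (u n) - (real n * norm (blinfun_apply f (u n))) *\<^sub>R y)"
    by metis
  define r where "r n = norm (blinfun_apply f (u n))" for n
  have r1: "r n \<le> 1" for n
    using norm_blinfun[of f "u n"] u[of n] by (simp add: r_def nf)
  have r0: "r n \<ge> 0" for n by (simp add: r_def)
  have r_lower: "1 - (norm V + c / 2) / real n \<le> r n" if "n > 0" for n
  proof -
    have "norm (blinfun_apply V (u n)) \<le> norm V"
      using norm_blinfun[of V "u n"] mult_left_mono[OF u[of n], of "norm V"] by simp
    moreover have "norm ((real n * r n) *\<^sub>R y) = real n * r n" by (simp add: y r_def)
    ultimately have "real n - c / 2 < norm V + real n * r n"
      using lower[of n] norm_triangle_ineq4[of "blinfun_apply V (u n)" "(real n * r n) *\<^sub>R y"]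
      unfolding r_def by linarith
    then show ?thesis using that by (simp add: field_simps)
  qed
  have r_lim: "r \<longlonglongrightarrow> 1"
  proof (rule tendsto_sandwich)
    show "\<forall>\<^sub>F n in sequentially. 1 - (norm V + c / 2) / real n \<le> r n"
      using eventually_gt_at_top[of 0] by eventually_elim (rule r_lower)
    show "\<forall>\<^sub>F n in sequentially. r n \<le> 1" using r1 by simp
    have "(\<lambda>n. (norm V + c / 2) / real n) \<longlonglongrightarrow> 0" by (rule lim_const_over_n)
    from tendsto_diff[OF tendsto_const this]
    show "(\<lambda>n. 1 - (norm V + c / 2) / real n) \<longlonglongrightarrow> 1" by simp
  qed simp
  have "u \<longlonglongrightarrow> x"
  proof (rule exposed)
    show "u n \<in> cball 0 1" for n using u by simp
    have "(\<lambda>n. of_real (r n) :: 'k) \<longlonglongrightarrow> of_real 1" by (rule tendsto_of_real[OF r_lim])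
    then show "(\<lambda>n. blinfun_apply f (u n)) \<longlonglongrightarrow> 1" by (simp add: r_def flip: fu)
  qed
  then have "(\<lambda>n. blinfun_apply V (u n - x)) \<longlonglongrightarrow> blinfun_apply V (x - x)"
    by (intro tendsto_intros)
  then have "(\<lambda>n. norm (blinfun_apply V (u n - x))) \<longlonglongrightarrow> 0"
    by (simp add: tendsto_norm_zero blinfun.zero_right)
  then have small: "\<forall>\<^sub>F n in sequentially. norm (blinfun_apply V (u n - x)) < c / 2"
    using \<open>c > 0\<close> by (intro order_tendstoD) auto
  have large: "\<forall>\<^sub>F n in sequentially. real n \<ge> 2 * c"
    using filterlim_real_sequentially by (simp add: filterlim_at_top)
  have half: "\<forall>\<^sub>F n in sequentially. r n > 1 / 2"
    using r_lim by (rule order_tendstoD) simp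
  have "\<forall>\<^sub>F n in sequentially. False"
    using small large half
  proof eventually_elim
    case (elim n)
    have "real n * (1 / 2) \<le> real n * r n" using elim by (intro mult_left_mono) auto
    then have nr: "c \<le> real n * r n" using elim by linarith
    have "real n * r n \<le> real n" using r1[of n] by (simp add: mult_left_le)
    moreover have "blinfun_apply V (u n) - (real n * r n) *\<^sub>R y
        = blinfun_apply V (u n - x) + (c - real n * r n) *\<^sub>R y"
      by (simp add: blinfun.diff_right Vx algebra_simps)
    moreover have "norm ((c - real n * r n) *\<^sub>R y) = real n * r n - c" using nr by (simp add: y)
    ultimately show False
      using lower[of n] elim
        norm_triangle_ineq[of "blinfun_apply V (u n - x)" "(c - real n * r n) *\<^sub>R y"]
      unfolding r_def by simp
  qed
  then show False by simp
qed

lemma zero_if_vanishes_on_separating: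
  fixes sX :: "'k::real_or_complex \<Rightarrow> 'x::banach \<Rightarrow> 'x"
    and sY :: "'k \<Rightarrow> 'y::banach \<Rightarrow> 'y"
  assumes X: "banach_over sX" and Y: "banach_over sY"
    and D: "separates_dual sX D"
    and V: "V \<in> bounded_ops sX sY" and zero: "\<And>x. x \<in> D \<Longrightarrow> blinfun_apply V x = 0"
  shows "V = 0"
proof (rule blinfun_eqI, rule ccontr)
  fix x assume "blinfun_apply V x \<noteq> blinfun_apply 0 x"
  then obtain g where g: "g \<in> dual_space sY" and gVx: "blinfun_apply g (blinfun_apply V x) \<noteq> 0"
    using ex_dual_nonzero[OF Y] by (metis blinfun.zero_left)
  have "g o\<^sub>L V \<in> dual_space sX"
    using g V by (simp add: dual_space_iff[OF X] dual_space_iff[OF Y] bounded_ops_iff[OF X Y])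
  moreover have "g o\<^sub>L V \<noteq> 0" using gVx by (metis blinfun.zero_left blinfun_apply_blinfun_compose)
  ultimately obtain d where "d \<in> D" "blinfun_apply (g o\<^sub>L V) d \<noteq> 0"
    using D unfolding separates_dual_def by blast
  then show False using zero by (simp add: blinfun.zero_right)
qed

theorem theorem3p40:
  fixes sX :: "'k::real_or_complex \<Rightarrow> 'x::banach \<Rightarrow> 'x"
    and sY :: "'k \<Rightarrow> 'y::banach \<Rightarrow> 'y"
  assumes "banach_over sX"
    and "banach_over sY"
    and "separates_dual sX {x. strongly_exposed_point sX x}"
  defines "K \<equiv> compact_ops sX sY"
    and "L \<equiv> bounded_ops sX sY"
  shows "(K = L \<or> (K \<subset> L \<and> anti_coproximinal (op_scale sY) K L)) \<and>
         \<not> (K = L \<and> (K \<subset> L \<and> anti_coproximinal (op_scale sY) K L))"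
proof -
  interpret ops: banach_over "op_scale sY :: 'k \<Rightarrow> ('x \<Rightarrow>\<^sub>L 'y) \<Rightarrow> _"
    by (rule banach_over_op_scale) fact
  have subK: "ops.subspace K" and subL: "ops.subspace L"
    unfolding K_def L_def
    by (rule subspace_compact_ops subspace_bounded_ops; fact)+
  have KL: "K \<subseteq> L" by (auto simp: K_def L_def compact_ops_def)
  have "\<not> best_coapproximation K v w0" if v: "v \<in> L - K" for v w0
  proof
    assume "best_coapproximation K v w0"
    then have w0: "w0 \<in> K" and best: "\<And>w. w \<in> K \<Longrightarrow> norm (w0 - w) \<le> norm (v - w)"
      by (auto simp: best_coapproximation_def)
    have V: "v - w0 \<in> bounded_ops sX sY"
      using v w0 KL ops.subspace_diff[OF subL, of v w0] by (auto simp: L_def)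
    have "norm W \<le> norm (v - w0 - W)" if "W \<in> compact_ops sX sY" for W
      using best[of "w0 + W"] ops.subspace_add[OF subK w0, of W] that
      by (simp add: K_def algebra_simps)
    then have "blinfun_apply (v - w0) x = 0" if "strongly_exposed_point sX x" for x
      using coapproximation_zero_at_exposed[OF assms(1,2) V] that by blast
    then have "v - w0 = 0"
      using zero_if_vanishes_on_separating[OF assms(1-3) V] by blast
    then show False using v w0 by simp
  qed
  then have "anti_coproximinal (op_scale sY) K L"
    using subK subL KL by (auto simp: anti_coproximinal_def)
  then show ?thesis using KL by auto
qed

end
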